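(* Let $\alpha\neq 0$, $\beta$ and $\gamma$ be real constants. For $x\in\mathbb{R}$ let $A_x:=\{x+a_1\varepsilon+a_2\varepsilon^2+a_3\varepsilon^3 : a_1,a_2,a_3\in\mathbb{R}\}\subseteq\mathcal{R}^{(4)}$, and let $\Lambda=\{\Lambda_x\}_{x\in\mathbb{R}}$ be given by the maps $\Lambda_x:\mathbf{D}^3(x)\to\mathbf{F}(A_x,\mathcal{R}^{(4)})$, $$\Lambda_x(f)(x+a_1\varepsilon+a_2\varepsilon^2+a_3\varepsilon^3):=f(x)+a_1f'(x)\,\varepsilon+\Big(a_2f'(x)+\tfrac12a_1^2f''(x)\Big)\varepsilon^2+\Big(a_3f'(x)+a_1a_2f''(x)+\tfrac16a_1^3f'''(x)\Big)\varepsilon^3 .$$ Let $\Omega_{\alpha,\beta,\gamma}:\mathbb{R}\to\mathcal{R}^{(4)}$ be given by $\Omega_{\alpha,\beta,\gamma}(x):=x+\alpha\varepsilon+\beta\varepsilon^2+\gamma\varepsilon^3$. For $y=y_0+y_1\varepsilon+y_2\varepsilon^2+y_3\varepsilon^3\in\mathcal{R}^{(4)}$ with $y_0,y_1,y_2,y_3\in\mathbb{R}$ define $$\Gamma_1(y):=\frac1\alpha y_1,\qquad \Gamma_2(y):=\frac{2}{\alpha^2}y_2-\frac{2\beta}{\alpha^3}y_1,\qquad \Gamma_3(y):=\frac{6}{\alpha^3}y_3-\frac{12\beta}{\alpha^4}y_2+\Big(\frac{12\beta^2}{\alpha^5}-\frac{6\gamma}{\alpha^4}\Big)y_1 .$$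 Then the $3$-tuple $\big(\Lambda,\Omega_{\alpha,\beta,\gamma},\{\Gamma_i\}_{i=1}^3\big)$ is a $3$-rd order automatic differentiation induced by $\mathcal{R}^{(4)}$.
   Context: $\mathcal{R}^{(4)}:=\mathbb{R}[X]/\langle X^k : k>3\rangle$ is the $4$-dimensional truncated polynomial real algebra, and $\varepsilon$ is the class of $X$; so $1,\varepsilon,\varepsilon^2,\varepsilon^3$ is a real basis and $\varepsilon^4=0$. For a set $S$ and a unital associative real algebra $A$, $\mathbf{F}(S,A)$ is the unital real algebra of all functions $S\to A$ with pointwise operations. For $x\in\mathbb{R}$ and $n\ge 1$, $\mathbf{D}^n(x)$ is the set of real-valued functions $f$ defined on an open interval of real numbers containing $x$ that have an $n$-th derivative at $x$ (i.e. $f$ is $(n-1)$-times differentiable near $x$ and $f^{(n-1)}$ is differentiable at $x$). Sums, scalar multiples and products of elements of $\mathbf{D}^n(x)$ are taken on a common open interval around $x$, and functions agreeing near $x$ are identified, so $\mathbf{D}^n(x)$ is a unital associative real algebra. For $g\in\mathbf{D}^n(x)$ and $f\in\mathbf{D}^n(g(x))$, the composition $f\circ g$ is considered on an open interval around $x$ on which it is defined. Definition. Let $A$ be a commutative associative unital real algebra with a decomposition $A=\bigoplus_{i=0}^m A_i$ into nonzero subspaces with $A_0=\mathbb{R}$ (the real multiples of the identity) and $A_iA_j\subseteq A_{i+j}$, where $A_{i+j}:=0$ if $i+j>m$ (a "real-like algebra"; $\mathcal{R}^{(4)}$ is one, with $m=3$ and $A_i=\mathbb{R}\varepsilon^i$).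 An $n$-th order automatic differentiation induced by $A$ is a triple $(\Lambda,\Omega,\{\Gamma_i\}_{i=1}^n)$ consisting of a map $\Omega:\mathbb{R}\to A$, maps $\Gamma_i:A\to\mathbb{R}$ for $1\le i\le n$, and a family $\Lambda=\{\Lambda_x\}_{x\in\mathbb{R}}$ of maps $\Lambda_x:\mathbf{D}^n(x)\to\mathbf{F}(A_x,A)$ with $A_x\subseteq A$, such that for every $x\in\mathbb{R}$: (i) $\Omega(x)\in A_x$ and $\Lambda_x$ is a real linear transformation; (ii) $\Lambda_x(f\cdot g)(\Omega(x))=\Lambda_x(f)(\Omega(x))\cdot\Lambda_x(g)(\Omega(x))$ for all $f,g\in\mathbf{D}^n(x)$; (iii) for all $g\in\mathbf{D}^n(x)$ and $f\in\mathbf{D}^n(g(x))$, one has $\Lambda_x(g)(\Omega(x))\in A_{g(x)}$ and $\Lambda_x(f\circ g)(\Omega(x))=\Lambda_{g(x)}(f)\big(\Lambda_x(g)(\Omega(x))\big)$; (iv) $\Gamma_i\big(\Lambda_x(f)(\Omega(x))\big)=f^{(i)}(x)$ for all $f\in\mathbf{D}^n(x)$ and $1\le i\le n$. *)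

theory Defs
  imports "HOL-Analysis.Analysis" "HOL-Computational_Algebra.Polynomial"
begin

section \<open>The truncated polynomial algebra\<close>

text \<open>The ideal of \<open>\<real>[X]\<close> generated by the powers \<open>X^k\<close> with \<open>k > 3\<close>: ideals generated by a set
  are spans in the ring viewed as a module over itself.\<close>

definition trunc_ideal :: "real poly set" where
  "trunc_ideal = module.span (*) {monom 1 k | k. k > 3}"

interpretation poly_self: module "(*) :: real poly \<Rightarrow> real poly \<Rightarrow> real poly"
  by unfold_locales (simp_all add: algebra_simps)

lemma coeff_trunc_ideal:
  assumes "p \<in> trunc_ideal" "i < 4"
  shows "coeff p i = 0"
  using assms(1) unfolding trunc_ideal_def
proof (induction rule: poly_self.span_induct_alt)
  case base
  show ?case by simp
next
  case (step c x y)
  then obtain k where "x = monom 1 k" "k > 3" by blast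
  then have "coeff (c * x) i = 0"
    using assms(2) by (auto simp: coeff_mult coeff_monom intro!: sum.neutral)
  with step show ?case by simp
qed

lemma trunc_ideal_0: "0 \<in> trunc_ideal"
  and trunc_ideal_add: "p \<in> trunc_ideal \<Longrightarrow> q \<in> trunc_ideal \<Longrightarrow> p + q \<in> trunc_ideal"
  and trunc_ideal_diff: "p \<in> trunc_ideal \<Longrightarrow> q \<in> trunc_ideal \<Longrightarrow> p - q \<in> trunc_ideal"
  and trunc_ideal_uminus: "p \<in> trunc_ideal \<Longrightarrow> - p \<in> trunc_ideal"
  and trunc_ideal_mult: "p \<in> trunc_ideal \<Longrightarrow> r * p \<in> trunc_ideal"
  unfolding trunc_ideal_def
  by (auto intro: poly_self.span_zero poly_self.span_add poly_self.span_diff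
      poly_self.span_neg poly_self.span_scale)

lemma trunc_ideal_eq: "p = q \<Longrightarrow> p - q \<in> trunc_ideal"
  by (simp add: trunc_ideal_0)

quotient_type R4 = "real poly" / "\<lambda>p q. p - q \<in> trunc_ideal"
proof (rule equivpI)
  show "reflp (\<lambda>p q. p - q \<in> trunc_ideal)"
    by (rule reflpI) (simp add: trunc_ideal_0)
  show "symp (\<lambda>p q. p - q \<in> trunc_ideal)"
    by (rule sympI) (drule trunc_ideal_uminus, simp)
  show "transp (\<lambda>p q. p - q \<in> trunc_ideal)"
    by (rule transpI) (drule (1) trunc_ideal_add, simp)
qed

instantiation R4 :: comm_ring_1
begin

lift_definition zero_R4 :: R4 is 0 .
lift_definition one_R4 :: R4 is 1 .
lift_definition plus_R4 :: "R4 \<Rightarrow> R4 \<Rightarrow> R4" is "(+)"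
  by (drule (1) trunc_ideal_add) (simp add: algebra_simps)
lift_definition minus_R4 :: "R4 \<Rightarrow> R4 \<Rightarrow> R4" is "(-)"
  by (drule (1) trunc_ideal_diff) (simp add: algebra_simps)
lift_definition uminus_R4 :: "R4 \<Rightarrow> R4" is uminus
  by (drule trunc_ideal_uminus) (simp add: algebra_simps)
lift_definition times_R4 :: "R4 \<Rightarrow> R4 \<Rightarrow> R4" is "(*)"
proof -
  fix p p' q q' :: "real poly"
  assume "p - p' \<in> trunc_ideal" "q - q' \<in> trunc_ideal"
  then have "q * (p - p') + p' * (q - q') \<in> trunc_ideal"
    by (intro trunc_ideal_add trunc_ideal_mult)
  then show "p * q - p' * q' \<in> trunc_ideal"
    by (simp add: algebra_simps)
qed

instance
proof
  fix a b c :: R4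
  show "a * b * c = a * (b * c)" by transfer (rule trunc_ideal_eq, rule mult.assoc)
  show "a * b = b * a" by transfer (rule trunc_ideal_eq, rule mult.commute)
  show "1 * a = a" by transfer (rule trunc_ideal_eq, rule mult_1_left)
  show "a + b + c = a + (b + c)" by transfer (rule trunc_ideal_eq, rule add.assoc)
  show "a + b = b + a" by transfer (rule trunc_ideal_eq, rule add.commute)
  show "0 + a = a" by transfer (rule trunc_ideal_eq, rule add_0_left)
  show "- a + a = 0" by transfer (rule trunc_ideal_eq, rule left_minus)
  show "a - b = a + - b" by transfer (rule trunc_ideal_eq, rule diff_conv_add_uminus)
  show "(a + b) * c = a * c + b * c" by transfer (rule trunc_ideal_eq, rule distrib_right)
  show "(0::R4) \<noteq> 1"
  proof (transfer, rule notI)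
    assume "(0::real poly) - 1 \<in> trunc_ideal"
    from coeff_trunc_ideal[OF this, of 0] show False by simp
  qed
qed

end

instantiation R4 :: real_algebra_1
begin

lift_definition scaleR_R4 :: "real \<Rightarrow> R4 \<Rightarrow> R4" is smult
proof -
  fix c :: real and p q :: "real poly"
  assume "p - q \<in> trunc_ideal"
  from trunc_ideal_mult[OF this, of "[:c:]"] show "smult c p - smult c q \<in> trunc_ideal"
    by (simp add: smult_diff_right)
qed

instance
proof
  fix a b :: real and x y :: R4
  show "a *\<^sub>R (x + y) = a *\<^sub>R x + a *\<^sub>R y"
    by transfer (rule trunc_ideal_eq, rule smult_add_right)
  show "(a + b) *\<^sub>R x = a *\<^sub>R x + b *\<^sub>R x"
    by transfer (rule trunc_ideal_eq, rule smult_add_left)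
  show "a *\<^sub>R b *\<^sub>R x = (a * b) *\<^sub>R x" by transfer (rule trunc_ideal_eq, rule smult_smult)
  show "1 *\<^sub>R x = x" by transfer (rule trunc_ideal_eq, rule smult_1_left)
  show "a *\<^sub>R x * y = a *\<^sub>R (x * y)" by transfer (rule trunc_ideal_eq, rule mult_smult_left)
  show "x * a *\<^sub>R y = a *\<^sub>R (x * y)" by transfer (rule trunc_ideal_eq, rule mult_smult_right)
qed

end

lift_definition eps :: R4 is "monom 1 1" .

text \<open>\<open>R4_coord y i\<close> is the coordinate of \<open>y\<close> at \<open>eps ^ i\<close>; for \<open>i < 4\<close> the coefficient does not
  depend on the representing polynomial.\<close>

lift_definition R4_coord :: "R4 \<Rightarrow> nat \<Rightarrow> real" is "\<lambda>p i. if i < 4 then coeff p i else 0"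
  using coeff_trunc_ideal by fastforce

lemma eps_power: "eps ^ k = abs_R4 (monom 1 k)"
proof (induction k)
  case 0
  then show ?case by (simp add: one_R4.abs_eq one_poly_eq_simps(1))
next
  case (Suc k)
  then show ?case by (simp add: eps_def times_R4.abs_eq mult_monom)
qed

lemma R4_coord_combination:
  fixes y\<^sub>0 y\<^sub>1 y\<^sub>2 y\<^sub>3 :: real
  defines "y \<equiv> of_real y\<^sub>0 + y\<^sub>1 *\<^sub>R eps + y\<^sub>2 *\<^sub>R eps ^ 2 + y\<^sub>3 *\<^sub>R eps ^ 3"
  shows "R4_coord y 0 = y\<^sub>0" "R4_coord y 1 = y\<^sub>1" "R4_coord y 2 = y\<^sub>2" "R4_coord y 3 = y\<^sub>3"
proof -
  have "y = abs_R4 (smult y\<^sub>0 1 + smult y\<^sub>1 (monom 1 1) + smult y\<^sub>2 (monom 1 2) + smult y\<^sub>3 (monom 1 3))"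
    unfolding y_def of_real_def eps_power unfolding eps_def
    by (simp only: one_R4.abs_eq scaleR_R4.abs_eq plus_R4.abs_eq)
  then show "R4_coord y 0 = y\<^sub>0" "R4_coord y 1 = y\<^sub>1" "R4_coord y 2 = y\<^sub>2" "R4_coord y 3 = y\<^sub>3"
    by (simp_all add: R4_coord.abs_eq coeff_monom coeff_pCons split: nat.split)
qed

lemma R4_expansion:
  "y = of_real (R4_coord y 0) + R4_coord y 1 *\<^sub>R eps + R4_coord y 2 *\<^sub>R eps ^ 2 + R4_coord y 3 *\<^sub>R eps ^ 3"
proof -
  obtain p where y: "y = abs_R4 p" by (induction y rule: R4.abs_induct) blast
  let ?q = "smult (coeff p 0) 1 + smult (coeff p 1) (monom 1 1) + smult (coeff p 2) (monom 1 2)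
    + smult (coeff p 3) (monom 1 3)"
  let ?d = "p - ?q"
  have low: "coeff ?d i = 0" if "i < 4" for i
  proof -
    have "i = 0 \<or> i = 1 \<or> i = 2 \<or> i = 3" using that by auto
    then show ?thesis by (auto simp: coeff_monom coeff_pCons split: nat.split)
  qed
  have "monom (coeff ?d i) i \<in> trunc_ideal" for i
  proof (cases "i < 4")
    case True
    then show ?thesis by (simp only: low monom_eq_0 trunc_ideal_0)
  next
    case False
    then have "monom 1 i \<in> trunc_ideal"
      unfolding trunc_ideal_def by (intro poly_self.span_base) auto
    from trunc_ideal_mult[OF this, of "[:coeff ?d i:]"] show ?thesis
      by (simp add: smult_monom)
  qed
  then have "(\<Sum>i\<le>degree ?d. monom (coeff ?d i) i) \<in> trunc_ideal"
    unfolding trunc_ideal_def by (intro poly_self.span_sum)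
  then have "?d \<in> trunc_ideal"
    by (simp only: poly_as_sum_of_monoms)
  then have "y = abs_R4 ?q"
    unfolding y R4.abs_eq_iff .
  moreover have "of_real (R4_coord y 0) + R4_coord y 1 *\<^sub>R eps + R4_coord y 2 *\<^sub>R eps ^ 2
      + R4_coord y 3 *\<^sub>R eps ^ 3 = abs_R4 ?q"
    unfolding of_real_def eps_power y unfolding eps_def
    by (simp add: R4_coord.abs_eq one_R4.abs_eq scaleR_R4.abs_eq plus_R4.abs_eq)
  ultimately show ?thesis by simp
qed

lemma eps_power_4: "eps ^ 4 = 0"
proof -
  have "monom 1 4 \<in> trunc_ideal"
    unfolding trunc_ideal_def by (intro poly_self.span_base) auto
  then show ?thesis
    by (simp add: eps_power zero_R4.abs_eq R4.abs_eq_iff)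
qed

section \<open>Automatic differentiation\<close>

text \<open>\<open>D_at n x\<close> (for \<open>n \<ge> 1\<close>) represents the germs at \<open>x\<close> of functions with an \<open>n\<close>-th derivative at \<open>x\<close>
  by total functions. A function on an open interval around \<open>x\<close> is represented by any of its
  extensions; membership and the derivatives at \<open>x\<close> depend only on the values near \<open>x\<close>.\<close>

definition D_at :: "nat \<Rightarrow> real \<Rightarrow> (real \<Rightarrow> real) set" where
  "D_at n x = {f. (\<forall>k<n - 1. \<forall>\<^sub>F t in nhds x. (deriv ^^ k) f differentiable (at t)) \<and>
    (deriv ^^ (n - 1)) f differentiable (at x)}"

text \<open>\<open>G i\<close> is the component of degree \<open>i\<close> of a grading with degrees \<open>0, \<dots>, m\<close>.\<close>

definition real_like_algebra :: "nat \<Rightarrow> (nat \<Rightarrow> 'a::{comm_ring_1,real_algebra_1} set) \<Rightarrow> bool" where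
  "real_like_algebra m G \<longleftrightarrow>
    (\<forall>i\<le>m. subspace (G i) \<and> G i \<noteq> {0}) \<and>
    (\<forall>a. \<exists>!c. c \<in> (\<Pi>\<^sub>E i\<in>{..m}. G i) \<and> a = (\<Sum>i\<le>m. c i)) \<and>
    G 0 = range of_real \<and>
    (\<forall>i\<le>m. \<forall>j\<le>m. \<forall>a\<in>G i. \<forall>b\<in>G j. a * b \<in> (if i + j \<le> m then G (i + j) else {0}))"

text \<open>\<open>A x\<close> is the domain of the functions \<open>\<Lambda> x f\<close>; the algebra of all functions from \<open>A x\<close> to the
  type \<open>'a\<close> is \<open>A x \<rightarrow>\<^sub>E UNIV\<close>. Since elements of \<open>D_at n x\<close> only represent germs, \<open>\<Lambda> x\<close> is required to
  take equal values on functions that agree near \<open>x\<close>.\<close>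

definition automatic_differentiation ::
  "nat \<Rightarrow> (nat \<Rightarrow> 'a::{comm_ring_1,real_algebra_1} set) \<Rightarrow> nat \<Rightarrow> (real \<Rightarrow> 'a set) \<Rightarrow>
   (real \<Rightarrow> (real \<Rightarrow> real) \<Rightarrow> 'a \<Rightarrow> 'a) \<Rightarrow> (real \<Rightarrow> 'a) \<Rightarrow> (nat \<Rightarrow> 'a \<Rightarrow> real) \<Rightarrow> bool" where
  "automatic_differentiation m G n A \<Lambda> \<Omega> \<Gamma> \<longleftrightarrow>
    real_like_algebra m G \<and> n \<ge> 1 \<and>
    (\<forall>x.
      (\<forall>f\<in>D_at n x. \<Lambda> x f \<in> A x \<rightarrow>\<^sub>E UNIV) \<and>
      (\<forall>f\<in>D_at n x. \<forall>g\<in>D_at n x. (\<forall>\<^sub>F t in nhds x. f t = g t) \<longrightarrow> \<Lambda> x f = \<Lambda> x g) \<and>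
      \<Omega> x \<in> A x \<and>
      (\<forall>f\<in>D_at n x. \<forall>g\<in>D_at n x. \<Lambda> x (\<lambda>t. f t + g t) = (\<lambda>a\<in>A x. \<Lambda> x f a + \<Lambda> x g a)) \<and>
      (\<forall>c. \<forall>f\<in>D_at n x. \<Lambda> x (\<lambda>t. c * f t) = (\<lambda>a\<in>A x. c *\<^sub>R \<Lambda> x f a)) \<and>
      (\<forall>f\<in>D_at n x. \<forall>g\<in>D_at n x. \<Lambda> x (\<lambda>t. f t * g t) (\<Omega> x) = \<Lambda> x f (\<Omega> x) * \<Lambda> x g (\<Omega> x)) \<and>
      (\<forall>g\<in>D_at n x. \<forall>f\<in>D_at n (g x). \<Lambda> x g (\<Omega> x) \<in> A (g x) \<and>
        \<Lambda> x (f \<circ> g) (\<Omega> x) = \<Lambda> (g x) f (\<Lambda> x g (\<Omega> x))) \<and>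
      (\<forall>f\<in>D_at n x. \<forall>i\<in>{1..n}. \<Gamma> i (\<Lambda> x f (\<Omega> x)) = (deriv ^^ i) f x))"

section \<open>The triples on the truncated polynomial algebra\<close>

definition R4_grading :: "nat \<Rightarrow> R4 set" where
  "R4_grading i = {c *\<^sub>R eps ^ i | c. True}"

definition R4_dom :: "real \<Rightarrow> R4 set" where
  "R4_dom x = {of_real x + a\<^sub>1 *\<^sub>R eps + a\<^sub>2 *\<^sub>R eps ^ 2 + a\<^sub>3 *\<^sub>R eps ^ 3 | a\<^sub>1 a\<^sub>2 a\<^sub>3. True}"

definition R4_Lambda :: "real \<Rightarrow> (real \<Rightarrow> real) \<Rightarrow> R4 \<Rightarrow> R4" where
  "R4_Lambda x f = (\<lambda>y\<in>R4_dom x.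
    let a\<^sub>1 = R4_coord y 1; a\<^sub>2 = R4_coord y 2; a\<^sub>3 = R4_coord y 3;
        f' = deriv f x; f'' = (deriv ^^ 2) f x; f''' = (deriv ^^ 3) f x
    in of_real (f x) + (a\<^sub>1 * f') *\<^sub>R eps
       + (a\<^sub>2 * f' + 1/2 * a\<^sub>1\<^sup>2 * f'') *\<^sub>R eps ^ 2
       + (a\<^sub>3 * f' + a\<^sub>1 * a\<^sub>2 * f'' + 1/6 * a\<^sub>1 ^ 3 * f''') *\<^sub>R eps ^ 3)"

lemma R4_Lambda_combination:
  "R4_Lambda x f (of_real x + a\<^sub>1 *\<^sub>R eps + a\<^sub>2 *\<^sub>R eps ^ 2 + a\<^sub>3 *\<^sub>R eps ^ 3) =
    of_real (f x) + (a\<^sub>1 * deriv f x) *\<^sub>R eps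
     + (a\<^sub>2 * deriv f x + 1/2 * a\<^sub>1\<^sup>2 * (deriv ^^ 2) f x) *\<^sub>R eps ^ 2
     + (a\<^sub>3 * deriv f x + a\<^sub>1 * a\<^sub>2 * (deriv ^^ 2) f x + 1/6 * a\<^sub>1 ^ 3 * (deriv ^^ 3) f x) *\<^sub>R eps ^ 3"
proof -
  have "of_real x + a\<^sub>1 *\<^sub>R eps + a\<^sub>2 *\<^sub>R eps ^ 2 + a\<^sub>3 *\<^sub>R eps ^ 3 \<in> R4_dom x"
    unfolding R4_dom_def by blast
  then show ?thesis
    unfolding R4_Lambda_def Let_def restrict_apply by (simp only: R4_coord_combination if_True)
qed

definition R4_Omega :: "real \<Rightarrow> real \<Rightarrow> real \<Rightarrow> real \<Rightarrow> R4" where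
  "R4_Omega \<alpha> \<beta> \<gamma> x = of_real x + \<alpha> *\<^sub>R eps + \<beta> *\<^sub>R eps ^ 2 + \<gamma> *\<^sub>R eps ^ 3"

definition R4_Gamma :: "real \<Rightarrow> real \<Rightarrow> real \<Rightarrow> nat \<Rightarrow> R4 \<Rightarrow> real" where
  "R4_Gamma \<alpha> \<beta> \<gamma> i y =
    (let y\<^sub>1 = R4_coord y 1; y\<^sub>2 = R4_coord y 2; y\<^sub>3 = R4_coord y 3 in
     if i = 1 then 1 / \<alpha> * y\<^sub>1
     else if i = 2 then 2 / \<alpha>\<^sup>2 * y\<^sub>2 - 2 * \<beta> / \<alpha> ^ 3 * y\<^sub>1
     else if i = 3 then 6 / \<alpha> ^ 3 * y\<^sub>3 - 12 * \<beta> / \<alpha> ^ 4 * y\<^sub>2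
       + (12 * \<beta>\<^sup>2 / \<alpha> ^ 5 - 6 * \<gamma> / \<alpha> ^ 4) * y\<^sub>1
     else 0)"

end

theory Submission
  imports Defs
begin

text \<open>
  Write \<open>y = x + h\<close> with \<open>h = a\<^sub>1 \<epsilon> + a\<^sub>2 \<epsilon>\<^sup>2 + a\<^sub>3 \<epsilon>\<^sup>3\<close> nilpotent, \<open>h\<^sup>4 = 0\<close>. Expanding powers of \<open>h\<close> shows
  that \<open>R4_Lambda x f y\<close> is the Taylor sum \<open>f x + f' x h + f'' x h\<^sup>2 / 2 + f''' x h\<^sup>3 / 6\<close>: the third
  Taylor polynomial of \<open>f\<close> at \<open>x\<close>, evaluated at the nilpotent increment. Taylor polynomials add
  and scale; modulo fourth powers of the increment they multiply and compose as functions do.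
  Since the fourth power of a nilpotent element vanishes, these laws become exact identities, at
  every point of \<open>R4_dom x\<close> and in particular at \<open>R4_Omega \<alpha> \<beta> \<gamma> x\<close>. In coordinates they say that the
  derivatives at \<open>x\<close> obey the Leibniz rule (\<open>higher_deriv_mult_at\<close>) and the chain rule of Faa di
  Bruno (\<open>higher_deriv_compose_at\<close>) up to order three.

  The coordinates of \<open>R4_Lambda x f (R4_Omega \<alpha> \<beta> \<gamma> x)\<close> at \<open>\<epsilon>, \<epsilon>\<^sup>2, \<epsilon>\<^sup>3\<close> depend on \<open>f' x, f'' x, f''' x\<close>
  through a triangular linear system with diagonal \<open>\<alpha>, \<alpha>\<^sup>2 / 2, \<alpha>\<^sup>3 / 6\<close>. As \<open>\<alpha> \<noteq> 0\<close> it can be solved,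
  and \<open>R4_Gamma\<close> is its solution (\<open>R4_Gamma_Lambda\<close>).
\<close>

section \<open>Derivatives up to order three at a point\<close>

text \<open>The derivative operator is total, so \<open>deriv f t\<close> means something only where \<open>f\<close> is
  differentiable. Membership in \<open>D_at 3 x\<close> is therefore used in this form, which
  the differentiation rules accept.\<close>

lemma D_at_3D:
  assumes "f \<in> D_at 3 x"
  shows "\<forall>\<^sub>F t in nhds x. (f has_real_derivative deriv f t) (at t)"
    and "\<forall>\<^sub>F t in nhds x. (deriv f has_real_derivative (deriv ^^ 2) f t) (at t)"
    and "((deriv ^^ 2) f has_real_derivative (deriv ^^ 3) f x) (at x)"
proof -
  have *: "(h has_real_derivative deriv h t) (at t)" if "h differentiable at t" for h :: "real \<Rightarrow> real" and t
    using that DERIV_deriv_iff_real_differentiable by blast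
  have ev: "\<forall>\<^sub>F t in nhds x. (deriv ^^ k) f differentiable (at t)" if "k < 2" for k
    using assms that by (auto simp: D_at_def)
  show "\<forall>\<^sub>F t in nhds x. (f has_real_derivative deriv f t) (at t)"
    using ev[of 0] by (auto elim!: eventually_mono intro: *)
  show "\<forall>\<^sub>F t in nhds x. (deriv f has_real_derivative (deriv ^^ 2) f t) (at t)"
    using ev[of 1] by (auto elim!: eventually_mono dest!: * simp: eval_nat_numeral)
  have "(deriv ^^ 2) f differentiable (at x)"
    using assms by (auto simp: D_at_def)
  from *[OF this] show "((deriv ^^ 2) f has_real_derivative (deriv ^^ 3) f x) (at x)"
    by (simp add: eval_nat_numeral)
qed

text \<open>A converse: the derivatives at \<open>x\<close> can be read off from candidates \<open>f\<^sub>1\<close>, \<open>f\<^sub>2\<close>, \<open>d\<close>.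
  The first two must be derivatives in a whole neighbourhood, because each is differentiated once
  more; the last is needed at \<open>x\<close> alone. This reduces each calculus rule below to
  differentiating explicit expressions.\<close>

lemma higher_deriv_eqI:
  assumes f: "\<forall>\<^sub>F t in nhds x. (f has_real_derivative f\<^sub>1 t) (at t)"
    and f1: "\<forall>\<^sub>F t in nhds x. (f\<^sub>1 has_real_derivative f\<^sub>2 t) (at t)"
    and f2: "(f\<^sub>2 has_real_derivative d) (at x)"
  shows "deriv f x = f\<^sub>1 x" "(deriv ^^ 2) f x = f\<^sub>2 x" "(deriv ^^ 3) f x = d"
proof -
  have e1: "\<forall>\<^sub>F t in nhds x. deriv f t = f\<^sub>1 t"
    using f by eventually_elim (rule DERIV_imp_deriv)
  \<comment> \<open>To differentiate \<open>deriv f = f\<^sub>1\<close> at a point \<open>t\<close>, the equation must hold near \<open>t\<close>.\<close>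
  have "\<forall>\<^sub>F t in nhds x. \<forall>\<^sub>F s in nhds t. deriv f s = f\<^sub>1 s"
    using e1 by (simp add: eventually_eventually)
  with f1 have e2: "\<forall>\<^sub>F t in nhds x. deriv (deriv f) t = f\<^sub>2 t"
    by eventually_elim (simp add: deriv_cong_ev DERIV_imp_deriv)
  show "deriv f x = f\<^sub>1 x" using e1 by (rule eventually_nhds_x_imp_x)
  show "(deriv ^^ 2) f x = f\<^sub>2 x"
    using eventually_nhds_x_imp_x[OF e2] by (simp add: eval_nat_numeral)
  show "(deriv ^^ 3) f x = d"
    using deriv_cong_ev[OF e2 refl] DERIV_imp_deriv[OF f2] by (simp add: eval_nat_numeral)
qed

lemma higher_deriv_add_at:
  assumes "f \<in> D_at 3 x" "g \<in> D_at 3 x"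
  defines "h \<equiv> \<lambda>t. f t + g t"
  shows "deriv h x = deriv f x + deriv g x"
    and "(deriv ^^ 2) h x = (deriv ^^ 2) f x + (deriv ^^ 2) g x"
    and "(deriv ^^ 3) h x = (deriv ^^ 3) f x + (deriv ^^ 3) g x"
proof -
  note f = D_at_3D[OF assms(1)] and g = D_at_3D[OF assms(2)]
  have h: "\<forall>\<^sub>F t in nhds x. (h has_real_derivative deriv f t + deriv g t) (at t)"
    using f(1) g(1) unfolding h_def by eventually_elim (rule DERIV_add)
  have h1: "\<forall>\<^sub>F t in nhds x. ((\<lambda>t. deriv f t + deriv g t) has_real_derivative
      (deriv ^^ 2) f t + (deriv ^^ 2) g t) (at t)"
    using f(2) g(2) by eventually_elim (rule DERIV_add)
  show "deriv h x = deriv f x + deriv g x"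
    and "(deriv ^^ 2) h x = (deriv ^^ 2) f x + (deriv ^^ 2) g x"
    and "(deriv ^^ 3) h x = (deriv ^^ 3) f x + (deriv ^^ 3) g x"
    by (rule higher_deriv_eqI[OF h h1 DERIV_add[OF f(3) g(3)]])+
qed

lemma higher_deriv_cmult_at:
  fixes c :: real
  assumes "f \<in> D_at 3 x"
  defines "h \<equiv> \<lambda>t. c * f t"
  shows "deriv h x = c * deriv f x"
    and "(deriv ^^ 2) h x = c * (deriv ^^ 2) f x"
    and "(deriv ^^ 3) h x = c * (deriv ^^ 3) f x"
proof -
  note f = D_at_3D[OF assms(1)]
  have h: "\<forall>\<^sub>F t in nhds x. (h has_real_derivative c * deriv f t) (at t)"
    using f(1) unfolding h_def by eventually_elim (rule DERIV_cmult)
  have h1: "\<forall>\<^sub>F t in nhds x. ((\<lambda>t. c * deriv f t) has_real_derivative c * (deriv ^^ 2) f t) (at t)"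
    using f(2) by eventually_elim (rule DERIV_cmult)
  show "deriv h x = c * deriv f x"
    and "(deriv ^^ 2) h x = c * (deriv ^^ 2) f x"
    and "(deriv ^^ 3) h x = c * (deriv ^^ 3) f x"
    by (rule higher_deriv_eqI[OF h h1 DERIV_cmult[OF f(3)]])+
qed

lemma higher_deriv_mult_at:
  assumes "f \<in> D_at 3 x" "g \<in> D_at 3 x"
  defines "h \<equiv> \<lambda>t. f t * g t"
  shows "deriv h x = deriv f x * g x + f x * deriv g x"
    and "(deriv ^^ 2) h x = (deriv ^^ 2) f x * g x + 2 * deriv f x * deriv g x + f x * (deriv ^^ 2) g x"
    and "(deriv ^^ 3) h x = (deriv ^^ 3) f x * g x + 3 * (deriv ^^ 2) f x * deriv g x
      + 3 * deriv f x * (deriv ^^ 2) g x + f x * (deriv ^^ 3) g x"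
proof -
  note f = D_at_3D[OF assms(1)] and g = D_at_3D[OF assms(2)]
  let ?h1 = "\<lambda>t. deriv f t * g t + f t * deriv g t"
  let ?h2 = "\<lambda>t. (deriv ^^ 2) f t * g t + 2 * deriv f t * deriv g t + f t * (deriv ^^ 2) g t"
  have h: "\<forall>\<^sub>F t in nhds x. (h has_real_derivative ?h1 t) (at t)"
    using f(1) g(1) unfolding h_def
    by eventually_elim (auto intro!: derivative_eq_intros)
  have h1: "\<forall>\<^sub>F t in nhds x. (?h1 has_real_derivative ?h2 t) (at t)"
    using f(1,2) g(1,2)
    by eventually_elim (auto intro!: derivative_eq_intros)
  have h2: "(?h2 has_real_derivative (deriv ^^ 3) f x * g x + 3 * (deriv ^^ 2) f x * deriv g x
      + 3 * deriv f x * (deriv ^^ 2) g x + f x * (deriv ^^ 3) g x) (at x)"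
    using f(3) g(3) f(1,2)[THEN eventually_nhds_x_imp_x] g(1,2)[THEN eventually_nhds_x_imp_x]
    by (auto intro!: derivative_eq_intros simp: algebra_simps)
  show "deriv h x = deriv f x * g x + f x * deriv g x"
    and "(deriv ^^ 2) h x = (deriv ^^ 2) f x * g x + 2 * deriv f x * deriv g x + f x * (deriv ^^ 2) g x"
    and "(deriv ^^ 3) h x = (deriv ^^ 3) f x * g x + 3 * (deriv ^^ 2) f x * deriv g x
      + 3 * deriv f x * (deriv ^^ 2) g x + f x * (deriv ^^ 3) g x"
    by (rule higher_deriv_eqI[OF h h1 h2])+
qed

text \<open>What \<open>f\<close> satisfies near \<open>g x\<close> holds at \<open>g t\<close> for \<open>t\<close> near \<open>x\<close>, because \<open>g\<close> is continuous at \<open>x\<close>.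
  The chain and product rules then apply throughout a neighbourhood of \<open>x\<close>.\<close>

lemma higher_deriv_compose_at:
  assumes "g \<in> D_at 3 x" "f \<in> D_at 3 (g x)"
  shows "deriv (f \<circ> g) x = deriv f (g x) * deriv g x"
    and "(deriv ^^ 2) (f \<circ> g) x = (deriv ^^ 2) f (g x) * (deriv g x)\<^sup>2 + deriv f (g x) * (deriv ^^ 2) g x"
    and "(deriv ^^ 3) (f \<circ> g) x = (deriv ^^ 3) f (g x) * deriv g x ^ 3
      + 3 * (deriv ^^ 2) f (g x) * deriv g x * (deriv ^^ 2) g x + deriv f (g x) * (deriv ^^ 3) g x"
proof -
  note g = D_at_3D[OF assms(1)] and f = D_at_3D[OF assms(2)]
  have "isCont g x"
    using g(1)[THEN eventually_nhds_x_imp_x] by (rule DERIV_isCont)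
  then have "filterlim g (nhds (g x)) (nhds x)"
    by (simp add: isCont_def tendsto_at_iff_tendsto_nhds)
  note pull = eventually_compose_filterlim[OF _ this]
  let ?h1 = "\<lambda>t. deriv f (g t) * deriv g t"
  let ?h2 = "\<lambda>t. (deriv ^^ 2) f (g t) * (deriv g t)\<^sup>2 + deriv f (g t) * (deriv ^^ 2) g t"
  have h: "\<forall>\<^sub>F t in nhds x. ((f \<circ> g) has_real_derivative ?h1 t) (at t)"
    using pull[OF f(1)] g(1) by eventually_elim (rule DERIV_chain)
  have h1: "\<forall>\<^sub>F t in nhds x. (?h1 has_real_derivative ?h2 t) (at t)"
    using pull[OF f(2)] g(1,2)
  proof eventually_elim
    case (elim t)
    show ?case
      using DERIV_mult[OF DERIV_chain2[OF elim(1,2)] elim(3)]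
      by (simp add: power2_eq_square algebra_simps)
  qed
  have gx: "(g has_real_derivative deriv g x) (at x)"
      "(deriv g has_real_derivative (deriv ^^ 2) g x) (at x)"
    using g(1,2)[THEN eventually_nhds_x_imp_x] .
  have fx: "(deriv f has_real_derivative (deriv ^^ 2) f (g x)) (at (g x))"
    using f(2)[THEN eventually_nhds_x_imp_x] .
  have h2: "(?h2 has_real_derivative (deriv ^^ 3) f (g x) * deriv g x ^ 3
      + 3 * (deriv ^^ 2) f (g x) * deriv g x * (deriv ^^ 2) g x + deriv f (g x) * (deriv ^^ 3) g x) (at x)"
    using DERIV_add[OF DERIV_mult[OF DERIV_chain2[OF f(3) gx(1)] DERIV_power[OF gx(2), of 2]]
        DERIV_mult[OF DERIV_chain2[OF fx gx(1)] g(3)]]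
    by (rule back_subst[where P = "\<lambda>D. (?h2 has_real_derivative D) (at x)"])
       (simp add: algebra_simps power2_eq_square power3_eq_cube)
  show "deriv (f \<circ> g) x = deriv f (g x) * deriv g x"
    and "(deriv ^^ 2) (f \<circ> g) x = (deriv ^^ 2) f (g x) * (deriv g x)\<^sup>2 + deriv f (g x) * (deriv ^^ 2) g x"
    and "(deriv ^^ 3) (f \<circ> g) x = (deriv ^^ 3) f (g x) * deriv g x ^ 3
      + 3 * (deriv ^^ 2) f (g x) * deriv g x * (deriv ^^ 2) g x + deriv f (g x) * (deriv ^^ 3) g x"
    by (rule higher_deriv_eqI[OF h h1 h2])+
qed

section \<open>The graded algebra\<close>

lemma R4_mult_combination:
  "(of_real a\<^sub>0 + a\<^sub>1 *\<^sub>R eps + a\<^sub>2 *\<^sub>R eps ^ 2 + a\<^sub>3 *\<^sub>R eps ^ 3) *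
    (of_real b\<^sub>0 + b\<^sub>1 *\<^sub>R eps + b\<^sub>2 *\<^sub>R eps ^ 2 + b\<^sub>3 *\<^sub>R eps ^ 3) =
    of_real (a\<^sub>0 * b\<^sub>0) + (a\<^sub>0 * b\<^sub>1 + a\<^sub>1 * b\<^sub>0) *\<^sub>R eps
    + (a\<^sub>0 * b\<^sub>2 + a\<^sub>1 * b\<^sub>1 + a\<^sub>2 * b\<^sub>0) *\<^sub>R eps ^ 2
    + (a\<^sub>0 * b\<^sub>3 + a\<^sub>1 * b\<^sub>2 + a\<^sub>2 * b\<^sub>1 + a\<^sub>3 * b\<^sub>0) *\<^sub>R eps ^ 3"
proof -
  have "(a\<^sub>0 + a\<^sub>1 * e + a\<^sub>2 * e ^ 2 + a\<^sub>3 * e ^ 3) * (b\<^sub>0 + b\<^sub>1 * e + b\<^sub>2 * e ^ 2 + b\<^sub>3 * e ^ 3) =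
      a\<^sub>0 * b\<^sub>0 + (a\<^sub>0 * b\<^sub>1 + a\<^sub>1 * b\<^sub>0) * e + (a\<^sub>0 * b\<^sub>2 + a\<^sub>1 * b\<^sub>1 + a\<^sub>2 * b\<^sub>0) * e ^ 2
      + (a\<^sub>0 * b\<^sub>3 + a\<^sub>1 * b\<^sub>2 + a\<^sub>2 * b\<^sub>1 + a\<^sub>3 * b\<^sub>0) * e ^ 3
      + e ^ 4 * (a\<^sub>1 * b\<^sub>3 + a\<^sub>2 * b\<^sub>2 + a\<^sub>3 * b\<^sub>1 + (a\<^sub>2 * b\<^sub>3 + a\<^sub>3 * b\<^sub>2) * e + a\<^sub>3 * b\<^sub>3 * e ^ 2)"
    for a\<^sub>0 a\<^sub>1 a\<^sub>2 a\<^sub>3 b\<^sub>0 b\<^sub>1 b\<^sub>2 b\<^sub>3 e :: R4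
    by (simp add: algebra_simps eval_nat_numeral)
  \<comment> \<open>The last summand collects the terms of degree four to six, which \<open>\<epsilon>\<^sup>4 = 0\<close> annihilates.\<close>
  from this[where e = eps] show ?thesis
    by (simp add: scaleR_conv_of_real eps_power_4)
qed

lemma R4_add_combination:
  "(of_real a\<^sub>0 + a\<^sub>1 *\<^sub>R eps + a\<^sub>2 *\<^sub>R eps ^ 2 + a\<^sub>3 *\<^sub>R eps ^ 3) +
    (of_real b\<^sub>0 + b\<^sub>1 *\<^sub>R eps + b\<^sub>2 *\<^sub>R eps ^ 2 + b\<^sub>3 *\<^sub>R eps ^ 3) =
    of_real (a\<^sub>0 + b\<^sub>0) + (a\<^sub>1 + b\<^sub>1) *\<^sub>R eps + (a\<^sub>2 + b\<^sub>2) *\<^sub>R eps ^ 2 + (a\<^sub>3 + b\<^sub>3) *\<^sub>R eps ^ 3"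
  by (simp add: scaleR_add_left)

lemma R4_scaleR_combination:
  "c *\<^sub>R (of_real a\<^sub>0 + a\<^sub>1 *\<^sub>R eps + a\<^sub>2 *\<^sub>R eps ^ 2 + a\<^sub>3 *\<^sub>R eps ^ 3) =
    of_real (c * a\<^sub>0) + (c * a\<^sub>1) *\<^sub>R eps + (c * a\<^sub>2) *\<^sub>R eps ^ 2 + (c * a\<^sub>3) *\<^sub>R eps ^ 3"
  by (simp add: scaleR_conv_of_real algebra_simps)

lemma R4_combination_cong:
  assumes "a\<^sub>0 = b\<^sub>0" "a\<^sub>1 = b\<^sub>1" "a\<^sub>2 = b\<^sub>2" "a\<^sub>3 = b\<^sub>3"
  shows "of_real a\<^sub>0 + a\<^sub>1 *\<^sub>R eps + a\<^sub>2 *\<^sub>R eps ^ 2 + a\<^sub>3 *\<^sub>R eps ^ 3 =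
    of_real b\<^sub>0 + b\<^sub>1 *\<^sub>R eps + b\<^sub>2 *\<^sub>R eps ^ 2 + b\<^sub>3 *\<^sub>R eps ^ 3"
  using assms by simp

lemma R4_domE:
  assumes "y \<in> R4_dom x"
  obtains a\<^sub>1 a\<^sub>2 a\<^sub>3 where "y = of_real x + a\<^sub>1 *\<^sub>R eps + a\<^sub>2 *\<^sub>R eps ^ 2 + a\<^sub>3 *\<^sub>R eps ^ 3"
  using assms unfolding R4_dom_def by blast

text \<open>Directness of the sum is the linear independence of \<open>1, \<epsilon>, \<epsilon>\<^sup>2, \<epsilon>\<^sup>3\<close>: the coordinate functions
  recover the coefficients of any decomposition. Products of degree above three vanish because
  they contain the factor \<open>\<epsilon>\<^sup>4\<close>.\<close>

lemma real_like_algebra_R4: "real_like_algebra 3 R4_grading"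
proof -
  have "subspace (R4_grading i)" for i
  proof -
    have "R4_grading i = span {eps ^ i}"
      by (auto simp: R4_grading_def span_singleton)
    then show ?thesis by simp
  qed
  moreover have "R4_grading i \<noteq> {0}" if "i \<le> 3" for i
  proof -
    have "eps ^ i \<noteq> 0"
    proof
      assume "eps ^ i = 0"
      then have "monom 1 i \<in> trunc_ideal"
        by (simp add: eps_power zero_R4.abs_eq R4.abs_eq_iff)
      with coeff_trunc_ideal[of "monom 1 i" i] that show False by simp
    qed
    moreover have "eps ^ i \<in> R4_grading i"
      unfolding R4_grading_def by (rule CollectI, rule exI[of _ 1]) simp
    ultimately show ?thesis by blast
  qed
  moreover have "\<exists>!c. c \<in> (\<Pi>\<^sub>E i\<in>{..3}. R4_grading i) \<and> a = (\<Sum>i\<le>3. c i)" for a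
  proof (rule ex1I)
    have "(\<Sum>i\<le>3. R4_coord a i *\<^sub>R eps ^ i) = a"
      by (rule trans[OF _ R4_expansion[symmetric]]) (simp add: eval_nat_numeral of_real_def)
    then show "(\<lambda>i\<in>{..3}. R4_coord a i *\<^sub>R eps ^ i) \<in> (\<Pi>\<^sub>E i\<in>{..3}. R4_grading i) \<and>
        a = (\<Sum>i\<le>3. (\<lambda>i\<in>{..3}. R4_coord a i *\<^sub>R eps ^ i) i)"
      by (auto simp: R4_grading_def)
  next
    fix c
    assume c: "c \<in> (\<Pi>\<^sub>E i\<in>{..3}. R4_grading i) \<and> a = (\<Sum>i\<le>3. c i)"
    then have "\<forall>i\<in>{..3}. \<exists>r. c i = r *\<^sub>R eps ^ i"
      by (auto simp: R4_grading_def PiE_iff)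
    then obtain r where r: "\<And>i. i \<le> 3 \<Longrightarrow> c i = r i *\<^sub>R eps ^ i"
      unfolding bchoice_iff by auto
    have "a = (\<Sum>i\<le>3. r i *\<^sub>R eps ^ i)"
      using c r by simp
    also have "\<dots> = of_real (r 0) + r 1 *\<^sub>R eps + r 2 *\<^sub>R eps ^ 2 + r 3 *\<^sub>R eps ^ 3"
      by (simp add: eval_nat_numeral of_real_def)
    finally have a: "a = \<dots>" .
    have "R4_coord a i = r i" if "i \<le> 3" for i
    proof -
      have "i = 0 \<or> i = 1 \<or> i = 2 \<or> i = 3" using that by auto
      then show ?thesis unfolding a by (elim disjE) (simp_all only: R4_coord_combination)
    qed
    with r c show "c = (\<lambda>i\<in>{..3}. R4_coord a i *\<^sub>R eps ^ i)"
      by (intro ext) (auto simp: PiE_iff extensional_def)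
  qed
  moreover have "R4_grading 0 = range of_real"
    by (auto simp: R4_grading_def of_real_def)
  moreover have "a * b \<in> (if i + j \<le> 3 then R4_grading (i + j) else {0})"
    if "a \<in> R4_grading i" "b \<in> R4_grading j" for a b i j
  proof -
    obtain r s where "a = r *\<^sub>R eps ^ i" "b = s *\<^sub>R eps ^ j"
      using \<open>a \<in> R4_grading i\<close> \<open>b \<in> R4_grading j\<close> by (auto simp: R4_grading_def)
    then have ab: "a * b = (s * r) *\<^sub>R eps ^ (i + j)"
      by (simp add: power_add)
    show ?thesis
    proof (cases "i + j \<le> 3")
      case True
      with ab show ?thesis by (auto simp: R4_grading_def)
    next
      case False
      then have "eps ^ (i + j) = eps ^ 4 * eps ^ (i + j - 4)"
        by (simp flip: power_add)
      with ab False show ?thesis by (simp add: eps_power_4)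
    qed
  qed
  ultimately show ?thesis
    unfolding real_like_algebra_def by simp
qed

section \<open>The induced automatic differentiation\<close>

lemma R4_Lambda_cong_germ:
  assumes "\<forall>\<^sub>F t in nhds x. f t = g t"
  shows "R4_Lambda x f = R4_Lambda x g"
proof -
  have "(deriv ^^ k) f x = (deriv ^^ k) g x" for k
    using assms by (rule higher_deriv_cong_ev) simp
  from this[of 0] this[of 1] this[of 2] this[of 3] show ?thesis
    by (simp add: R4_Lambda_def)
qed

lemma R4_Lambda_add:
  assumes "f \<in> D_at 3 x" "g \<in> D_at 3 x"
  shows "R4_Lambda x (\<lambda>t. f t + g t) = (\<lambda>y\<in>R4_dom x. R4_Lambda x f y + R4_Lambda x g y)"
proof (rule ext)
  fix y
  show "R4_Lambda x (\<lambda>t. f t + g t) y = (\<lambda>y\<in>R4_dom x. R4_Lambda x f y + R4_Lambda x g y) y"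
  proof (cases "y \<in> R4_dom x")
    case True
    then obtain a\<^sub>1 a\<^sub>2 a\<^sub>3
      where y: "y = of_real x + a\<^sub>1 *\<^sub>R eps + a\<^sub>2 *\<^sub>R eps ^ 2 + a\<^sub>3 *\<^sub>R eps ^ 3"
      by (rule R4_domE)
    have "R4_Lambda x (\<lambda>t. f t + g t) y = R4_Lambda x f y + R4_Lambda x g y"
      unfolding y R4_Lambda_combination R4_add_combination higher_deriv_add_at[OF assms]
      by (rule R4_combination_cong) (simp_all add: algebra_simps)
    with True show ?thesis by simp
  qed (simp add: R4_Lambda_def)
qed

lemma R4_Lambda_scaleR:
  assumes "f \<in> D_at 3 x"
  shows "R4_Lambda x (\<lambda>t. c * f t) = (\<lambda>y\<in>R4_dom x. c *\<^sub>R R4_Lambda x f y)"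
proof (rule ext)
  fix y
  show "R4_Lambda x (\<lambda>t. c * f t) y = (\<lambda>y\<in>R4_dom x. c *\<^sub>R R4_Lambda x f y) y"
  proof (cases "y \<in> R4_dom x")
    case True
    then obtain a\<^sub>1 a\<^sub>2 a\<^sub>3
      where y: "y = of_real x + a\<^sub>1 *\<^sub>R eps + a\<^sub>2 *\<^sub>R eps ^ 2 + a\<^sub>3 *\<^sub>R eps ^ 3"
      by (rule R4_domE)
    have "R4_Lambda x (\<lambda>t. c * f t) y = c *\<^sub>R R4_Lambda x f y"
      unfolding y R4_Lambda_combination R4_scaleR_combination higher_deriv_cmult_at[OF assms]
      by (rule R4_combination_cong) (simp_all add: algebra_simps)
    with True show ?thesis by simp
  qed (simp add: R4_Lambda_def)
qed

text \<open>Comparing coordinates leaves the Leibniz rule in orders zero to three.\<close>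

lemma R4_Lambda_mult:
  assumes "f \<in> D_at 3 x" "g \<in> D_at 3 x" "y \<in> R4_dom x"
  shows "R4_Lambda x (\<lambda>t. f t * g t) y = R4_Lambda x f y * R4_Lambda x g y"
proof -
  from assms(3) obtain a\<^sub>1 a\<^sub>2 a\<^sub>3
    where y: "y = of_real x + a\<^sub>1 *\<^sub>R eps + a\<^sub>2 *\<^sub>R eps ^ 2 + a\<^sub>3 *\<^sub>R eps ^ 3"
    by (rule R4_domE)
  show ?thesis
    unfolding y R4_Lambda_combination R4_mult_combination higher_deriv_mult_at[OF assms(1,2)]
    by (rule R4_combination_cong) (simp_all add: field_simps power2_eq_square power3_eq_cube)
qed

lemma R4_Lambda_in_dom:
  assumes "y \<in> R4_dom x"
  shows "R4_Lambda x f y \<in> R4_dom (f x)"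
  using assms unfolding R4_Lambda_def Let_def R4_dom_def by auto

text \<open>The right-hand side substitutes one Taylor polynomial into another; comparing coordinates leaves
  the chain rule up to order three.\<close>

lemma R4_Lambda_compose:
  assumes "g \<in> D_at 3 x" "f \<in> D_at 3 (g x)" "y \<in> R4_dom x"
  shows "R4_Lambda x (f \<circ> g) y = R4_Lambda (g x) f (R4_Lambda x g y)"
proof -
  from assms(3) obtain a\<^sub>1 a\<^sub>2 a\<^sub>3
    where y: "y = of_real x + a\<^sub>1 *\<^sub>R eps + a\<^sub>2 *\<^sub>R eps ^ 2 + a\<^sub>3 *\<^sub>R eps ^ 3"
    by (rule R4_domE)
  show ?thesis
    unfolding y R4_Lambda_combination higher_deriv_compose_at[OF assms(1,2)]
    by (rule R4_combination_cong) (simp_all add: field_simps power2_eq_square power3_eq_cube)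
qed

text \<open>The coordinates of the argument of \<open>R4_Gamma\<close> are \<open>y\<^sub>1 = \<alpha> f'\<close>, \<open>y\<^sub>2 = \<beta> f' + \<alpha>\<^sup>2 f'' / 2\<close> and
  \<open>y\<^sub>3 = \<gamma> f' + \<alpha> \<beta> f'' + \<alpha>\<^sup>3 f''' / 6\<close>; forward substitution for \<open>f'\<close>, \<open>f''\<close>, \<open>f'''\<close> yields the three
  formulas that define \<open>R4_Gamma\<close>.\<close>

lemma R4_Gamma_Lambda:
  assumes "\<alpha> \<noteq> 0" "i \<in> {1..3}"
  shows "R4_Gamma \<alpha> \<beta> \<gamma> i (R4_Lambda x f (R4_Omega \<alpha> \<beta> \<gamma> x)) = (deriv ^^ i) f x"
proof -
  have "i = 1 \<or> i = 2 \<or> i = 3" using assms(2) by auto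
  then show ?thesis
    unfolding R4_Gamma_def R4_Omega_def R4_Lambda_combination R4_coord_combination Let_def
    using assms(1) by (elim disjE) (simp_all add: field_simps power2_eq_square eval_nat_numeral)
qed

theorem proposition3p1:
  fixes \<alpha> \<beta> \<gamma> :: real
  assumes "\<alpha> \<noteq> 0"
  shows "automatic_differentiation 3 R4_grading 3 R4_dom R4_Lambda
    (R4_Omega \<alpha> \<beta> \<gamma>) (R4_Gamma \<alpha> \<beta> \<gamma>)"
proof -
  have Omega: "R4_Omega \<alpha> \<beta> \<gamma> x \<in> R4_dom x" for x
    unfolding R4_Omega_def R4_dom_def by blast
  have "R4_Lambda x f \<in> R4_dom x \<rightarrow>\<^sub>E UNIV" for x f
    by (simp add: R4_Lambda_def)
  then show ?thesis
    unfolding automatic_differentiation_def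
    using real_like_algebra_R4 Omega R4_Lambda_cong_germ R4_Lambda_add R4_Lambda_scaleR
      R4_Lambda_mult[OF _ _ Omega] R4_Lambda_in_dom[OF Omega] R4_Lambda_compose[OF _ _ Omega]
      R4_Gamma_Lambda[OF assms]
    by auto
qed

end
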